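(* Let $1\le m\le n$ be integers. If $n\ge 7$, then the complete bipartite graph $K_{m,n}$ is not a unit rectangle visibility graph.
   Context: A finite simple graph $G$ is a unit rectangle visibility graph (URVG) if its vertices $v$ can be represented by closed unit squares $S_v$ in the plane with sides parallel to the coordinate axes and with pairwise disjoint interiors (squares may touch along their boundaries), in such a way that two distinct vertices $v,w$ are adjacent if and only if there is an unobstructed non-degenerate (positive width) horizontal or vertical band of visibility joining $S_v$ and $S_w$. Here a horizontal band of visibility joining $S_v$ and $S_w$ is given by an open interval $I$ of positive length such that for every $y_0\in I$ the line $y=y_0$ meets the interiors of both $S_v$ and $S_w$, and the part of this line between $S_v$ and $S_w$ (possibly a single point if the squares touch) meets the interior of no other square of the representation; vertical bands are defined analogously with the roles of $x$ and $y$ exchanged. *)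

theory Defs
  imports "HOL-Analysis.Analysis" "Graph_Theory.Kuratowski"
begin

definition unit_square :: "(real \<times> real) set \<Rightarrow> bool" where
  "unit_square A \<longleftrightarrow> (\<exists>a b. A = {a..a + 1} \<times> {b..b + 1})"

text \<open>
  The part of the horizontal line at height \<open>y\<close> that lies between \<open>A\<close> and \<open>B\<close>. For squares
  \<open>A\<close> and \<open>B\<close> that the line meets, in this order, it is the closed segment from the last point
  of \<open>A\<close> to the first point of \<open>B\<close>, which is a single point if the squares touch there.
\<close>
definition between :: "(real \<times> real) set \<Rightarrow> (real \<times> real) set \<Rightarrow> real \<Rightarrow> (real \<times> real) set" where
  "between A B y = {(x, y) | x.
     (\<forall>s t. (s, y) \<in> A \<longrightarrow> (t, y) \<in> B \<longrightarrow> s \<le> x \<and> x \<le> t) \<or>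
     (\<forall>s t. (s, y) \<in> A \<longrightarrow> (t, y) \<in> B \<longrightarrow> t \<le> x \<and> x \<le> s)}"

definition horizontal_band ::
  "'a set \<Rightarrow> ('a \<Rightarrow> (real \<times> real) set) \<Rightarrow> 'a \<Rightarrow> 'a \<Rightarrow> bool" where
  "horizontal_band V S v w \<longleftrightarrow> (\<exists>a b. a < b \<and> (\<forall>y\<in>{a<..<b}.
     (\<exists>x. (x, y) \<in> interior (S v)) \<and> (\<exists>x. (x, y) \<in> interior (S w)) \<and>
     (\<forall>u\<in>V - {v, w}. between (S v) (S w) y \<inter> interior (S u) = {})))"

definition vertical_band ::
  "'a set \<Rightarrow> ('a \<Rightarrow> (real \<times> real) set) \<Rightarrow> 'a \<Rightarrow> 'a \<Rightarrow> bool" where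
  "vertical_band V S v w \<longleftrightarrow> horizontal_band V (\<lambda>u. prod.swap ` S u) v w"

definition unit_rectangle_visibility_representation ::
  "('a, 'b) pre_digraph \<Rightarrow> ('a \<Rightarrow> (real \<times> real) set) \<Rightarrow> bool" where
  "unit_rectangle_visibility_representation G S \<longleftrightarrow>
     (\<forall>v\<in>verts G. unit_square (S v)) \<and>
     (\<forall>v\<in>verts G. \<forall>w\<in>verts G. v \<noteq> w \<longrightarrow> interior (S v) \<inter> interior (S w) = {}) \<and>
     (\<forall>v\<in>verts G. \<forall>w\<in>verts G. v \<noteq> w \<longrightarrow>
        (v \<rightarrow>\<^bsub>G\<^esub> w \<longleftrightarrow> horizontal_band (verts G) S v w \<or> vertical_band (verts G) S v w))"

text \<open>
  The locale \<^locale>\<open>graph\<close> describes the finite simple graphs, encoded as finite symmetric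
  digraphs without loops and multiple arcs.
\<close>
definition unit_rectangle_visibility_graph :: "('a, 'b) pre_digraph \<Rightarrow> bool" where
  "unit_rectangle_visibility_graph G \<longleftrightarrow>
     graph G \<and> (\<exists>S. unit_rectangle_visibility_representation G S)"

end

theory Submission
  imports Defs
begin

text \<open>
  Let \<open>U\<close>, \<open>V\<close> be the two sides, with \<open>n\<close> squares in \<open>V\<close>, and fix \<open>u \<in> U\<close>; it has to see all of \<open>V\<close>.

  Suppose that above \<open>u\<close> there are visible \<open>v, w \<in> V\<close> whose projections to the horizontal axis
  overlap. Then a square of \<open>U\<close> must separate them, and an extremal choice produces a square
  \<open>v1 \<in> V\<close> above \<open>u\<close> and below a square \<open>u1 \<in> U\<close> with exactly the same projection. Since \<open>v1\<close>
  hides everything lower from \<open>u1\<close>, no square of \<open>V\<close> is lower than \<open>v1\<close>. Hence \<open>u\<close> sees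
  all of \<open>V\<close> above itself; of three squares jutting out on the same side the upper two would
  again give such a pair, contradicting the minimality, so \<open>n \<le> 4\<close>.

  Otherwise \<open>u\<close> sees at most two squares in each of the four directions. If it sees two above
  and two below, those jutting out to the left must be separated by some \<open>u' \<in> U\<close> to the left of
  the left edge of \<open>u\<close>, and then \<open>u\<close> hides from \<open>u'\<close> one of those jutting out to the right.
  So at most three squares are seen vertically and at most three horizontally, and \<open>n \<le> 6\<close>.
\<close>

section \<open>Minimizers and vertical lines of sight\<close>

lemma obtain_minimizer:
  fixes f :: "'a \<Rightarrow> real"
  assumes "finite A" "A \<noteq> {}"
  obtains x where "x \<in> A" "\<And>y. y \<in> A \<Longrightarrow> f x \<le> f y"
  using ex_is_arg_min_if_finite[OF assms, of f] unfolding is_arg_min_linorder by blast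

text \<open>
  \<open>X\<close> and \<open>Y\<close> give the lower left corners of the unit squares and the lines of sight are vertical;
  horizontal visibility is obtained by exchanging \<open>X\<close> and \<open>Y\<close>. Comparing only the \<open>Y\<close>-values
  detects obstruction because squares met by a common vertical line have distance at least 1 in \<open>Y\<close>.
\<close>
definition sees :: "'a set \<Rightarrow> ('a \<Rightarrow> real) \<Rightarrow> ('a \<Rightarrow> real) \<Rightarrow> 'a \<Rightarrow> 'a \<Rightarrow> bool" where
  "sees W X Y v w \<longleftrightarrow> (\<exists>p q. p < q \<and> (\<forall>t\<in>{p<..<q}.
     t \<in> {X v<..<X v + 1} \<and> t \<in> {X w<..<X w + 1} \<and>
     (\<forall>e\<in>W - {v, w}. t \<in> {X e<..<X e + 1} \<longrightarrow>
        \<not> (Y v < Y e \<and> Y e < Y w) \<and> \<not> (Y w < Y e \<and> Y e < Y v))))"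

text \<open>A square strictly between the two in height misses the whole band: a point common to its
  projection and the open interval from \<open>p\<close> to \<open>q\<close> would give an
  obstructed line.\<close>

lemma seesE:
  assumes "sees W X Y v w"
  obtains p q where "p < q" "X v \<le> p" "X w \<le> p" "q \<le> X v + 1" "q \<le> X w + 1"
    "\<And>e. e \<in> W \<Longrightarrow> Y v < Y e \<Longrightarrow> Y e < Y w \<Longrightarrow> X e + 1 \<le> p \<or> q \<le> X e"
    "\<And>e. e \<in> W \<Longrightarrow> Y w < Y e \<Longrightarrow> Y e < Y v \<Longrightarrow> X e + 1 \<le> p \<or> q \<le> X e"
proof -
  obtain p q where pq: "p < q" and *: "\<And>t. t \<in> {p<..<q} \<Longrightarrow>
     t \<in> {X v<..<X v + 1} \<and> t \<in> {X w<..<X w + 1} \<and>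
     (\<forall>e\<in>W - {v, w}. t \<in> {X e<..<X e + 1} \<longrightarrow>
        \<not> (Y v < Y e \<and> Y e < Y w) \<and> \<not> (Y w < Y e \<and> Y e < Y v))"
    using assms unfolding sees_def by blast
  have "{p<..<q} \<subseteq> {X v<..<X v + 1}" "{p<..<q} \<subseteq> {X w<..<X w + 1}"
    using * by blast+
  then have sub: "X v \<le> p" "q \<le> X v + 1" "X w \<le> p" "q \<le> X w + 1"
    using pq by (auto simp: greaterThanLessThan_subseteq_greaterThanLessThan)
  have gap: "X e + 1 \<le> p \<or> q \<le> X e"
    if e: "e \<in> W" "Y v < Y e \<and> Y e < Y w \<or> Y w < Y e \<and> Y e < Y v" for e
  proof (rule ccontr)
    assume "\<not> (X e + 1 \<le> p \<or> q \<le> X e)"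
    then have "max p (X e) < min q (X e + 1)" using pq by auto
    then obtain t where "max p (X e) < t" "t < min q (X e + 1)" using dense by blast
    then have "t \<in> {p<..<q}" "t \<in> {X e<..<X e + 1}" by auto
    with *[of t] e show False by force
  qed
  show thesis
    using that[of p q] pq sub gap by blast
qed

lemma seesI:
  assumes "p < q" "X v \<le> p" "X w \<le> p" "q \<le> X v + 1" "q \<le> X w + 1"
    and "\<And>e t. e \<in> W \<Longrightarrow> p < t \<Longrightarrow> t < q \<Longrightarrow> X e < t \<Longrightarrow> t < X e + 1 \<Longrightarrow>
      Y v < Y e \<and> Y e < Y w \<or> Y w < Y e \<and> Y e < Y v \<Longrightarrow> False"
  shows "sees W X Y v w"
  unfolding sees_def
proof (intro exI conjI ballI)
  show "p < q" by fact
next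
  fix t
  assume t: "t \<in> {p<..<q}"
  show "t \<in> {X v<..<X v + 1}" "t \<in> {X w<..<X w + 1}" using t assms(2-5) by auto
  show "t \<in> {X e<..<X e + 1} \<longrightarrow>
      \<not> (Y v < Y e \<and> Y e < Y w) \<and> \<not> (Y w < Y e \<and> Y e < Y v)" if "e \<in> W - {v, w}" for e
    using assms(6)[of e t] that t by auto
qed

lemma sees_overlap:
  assumes "sees W X Y v w"
  shows "\<bar>X v - X w\<bar> < 1"
  using assms by (elim seesE) linarith

lemma sees_uminus_right: "sees W X Y v w \<Longrightarrow> sees W X (\<lambda>e. - Y e) v w"
  by (simp add: sees_def conj_commute)

lemma sees_uminus_left:
  assumes "sees W X Y v w"
  shows "sees W (\<lambda>e. - X e) Y v w"
  using assms
proof (rule seesE)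
  fix p q
  assume "p < q" "X v \<le> p" "X w \<le> p" "q \<le> X v + 1" "q \<le> X w + 1"
    and "\<And>e. e \<in> W \<Longrightarrow> Y v < Y e \<Longrightarrow> Y e < Y w \<Longrightarrow> X e + 1 \<le> p \<or> q \<le> X e"
    and "\<And>e. e \<in> W \<Longrightarrow> Y w < Y e \<Longrightarrow> Y e < Y v \<Longrightarrow> X e + 1 \<le> p \<or> q \<le> X e"
  then show ?thesis
    \<comment> \<open>The map \<open>t \<mapsto> 1 - t\<close> sends a unit interval starting at
      \<open>X e\<close> to the one starting at \<open>- X e\<close>.\<close>
    by (intro seesI[of "1 - q" "1 - p"]) force+
qed

section \<open>Bipartite configurations and their symmetries\<close>

text \<open>The assumptions survive exchanging the coordinates and negating either one, so results
  on upward sight transfer to all four directions.\<close>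

locale bipartite_squares =
  fixes U V :: "'a set" and X Y :: "'a \<Rightarrow> real"
  assumes finite: "finite U" "finite V"
    and disjoint: "U \<inter> V = {}"
    and separated: "\<lbrakk>v \<in> U \<union> V; w \<in> U \<union> V; v \<noteq> w\<rbrakk> \<Longrightarrow> 1 \<le> \<bar>X v - X w\<bar> \<or> 1 \<le> \<bar>Y v - Y w\<bar>"
    and adjacent: "\<lbrakk>u \<in> U; v \<in> V\<rbrakk> \<Longrightarrow> sees (U \<union> V) X Y u v \<or> sees (U \<union> V) Y X u v"
    and independent:
      "\<lbrakk>v \<in> U \<and> w \<in> U \<or> v \<in> V \<and> w \<in> V; v \<noteq> w\<rbrakk> \<Longrightarrow>
        \<not> sees (U \<union> V) X Y v w \<and> \<not> sees (U \<union> V) Y X v w"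
begin

abbreviation "W \<equiv> U \<union> V"

lemma transposed: "bipartite_squares U V Y X"
  using finite disjoint separated adjacent independent
  by unfold_locales blast+

text \<open>Negating a coordinate of the corners reflects the squares and then translates them by 1.\<close>
lemma mirrored_left: "bipartite_squares U V (\<lambda>e. - X e) Y"
proof
  show "1 \<le> \<bar>- X v - - X w\<bar> \<or> 1 \<le> \<bar>Y v - Y w\<bar>" if "v \<in> W" "w \<in> W" "v \<noteq> w" for v w
    using separated[OF that] by linarith
  show "sees W (\<lambda>e. - X e) Y u v \<or> sees W Y (\<lambda>e. - X e) u v" if "u \<in> U" "v \<in> V" for u v
    using adjacent[OF that] sees_uminus_left[of W X Y u v] sees_uminus_right[of W Y X u v] by blast
  show "\<not> sees W (\<lambda>e. - X e) Y v w \<and> \<not> sees W Y (\<lambda>e. - X e) v w"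
    if "v \<in> U \<and> w \<in> U \<or> v \<in> V \<and> w \<in> V" "v \<noteq> w" for v w
    using independent[OF that] sees_uminus_left[of W "\<lambda>e. - X e" Y v w]
      sees_uminus_right[of W Y "\<lambda>e. - X e" v w] by auto
qed (use finite disjoint in auto)

lemma mirrored_right: "bipartite_squares U V X (\<lambda>e. - Y e)"
  by (rule bipartite_squares.transposed, rule bipartite_squares.mirrored_left, rule transposed)

lemma finite_W: "finite W"
  using finite by simp

lemma apart:
  assumes "v \<in> W" "w \<in> W" "v \<noteq> w" "\<bar>X v - X w\<bar> < 1"
  shows "1 \<le> \<bar>Y v - Y w\<bar>"
  using separated[of v w] assms by linarith

lemma sees_apart:
  assumes "sees W X Y u v" "u \<in> U" "v \<in> V"
  shows "1 \<le> \<bar>Y u - Y v\<bar>"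
  using apart[of u v] sees_overlap[OF assms(1)] assms disjoint by blast

section \<open>Strips and aligned stacks\<close>

definition strip :: "real \<Rightarrow> real \<Rightarrow> 'a set" where
  "strip l r = {e \<in> W. X e \<le> l \<and> r \<le> X e + 1}"

text \<open>Let \<open>l\<close> be the largest end of a projection left of \<open>P\<close>, or
  \<open>l0\<close> if that is larger. No projection ends strictly between \<open>l\<close> and
  \<open>P\<close>, so each one covers this interval or misses it.\<close>

lemma strip_left_of:
  assumes "l0 < P"
  obtains l where "l0 \<le> l" "l < P"
    "\<And>e. e \<in> W \<Longrightarrow> e \<in> strip l P \<or> P \<le> X e \<or> X e + 1 \<le> l"
    "\<And>e. e \<in> W \<Longrightarrow> X e < P \<Longrightarrow> X e \<le> l"
proof -
  define L where "L = insert l0 {x \<in> X ` W \<union> (\<lambda>e. X e + 1) ` W. x < P}"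
  have L: "finite L" "L \<noteq> {}" using finite_W by (auto simp: L_def)
  have "Max L < P" using L assms by (auto simp: L_def)
  moreover have le: "x \<le> Max L" if "x \<in> L" for x using that L by simp
  moreover have "X e \<le> Max L" if "e \<in> W" "X e < P" for e
    using that by (intro le) (auto simp: L_def)
  moreover have "X e + 1 \<le> Max L" if "e \<in> W" "X e + 1 < P" for e
    using that by (intro le) (auto simp: L_def)
  moreover have "l0 \<le> Max L" by (rule le) (auto simp: L_def)
  ultimately show thesis
    by (intro that[of "Max L"]) (force simp: strip_def)+
qed

text \<open>The lowest strip square above \<open>v\<close> is seen through the whole interval, since
  by \<open>clean\<close> any obstacle would lie in the strip too.\<close>

lemma next_above:
  assumes "l < r" and clean: "\<And>e. e \<in> W \<Longrightarrow> e \<in> strip l r \<or> r \<le> X e \<or> X e + 1 \<le> l"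
    and "v \<in> strip l r" "w \<in> strip l r" "Y v < Y w"
  obtains w' where "w' \<in> strip l r" "Y v < Y w'" "Y w' \<le> Y w" "sees W X Y v w'"
proof -
  let ?A = "{e \<in> strip l r. Y v < Y e}"
  have A: "finite ?A" "?A \<noteq> {}" using finite_W assms by (auto simp: strip_def)
  obtain w' where w': "w' \<in> ?A" "\<And>e. e \<in> ?A \<Longrightarrow> Y w' \<le> Y e"
    using obtain_minimizer[OF A, of Y] by blast
  have "sees W X Y v w'"
  proof (rule seesI[of l r])
    fix e t
    assume e: "e \<in> W" "l < t" "t < r" "X e < t" "t < X e + 1"
      and b: "Y v < Y e \<and> Y e < Y w' \<or> Y w' < Y e \<and> Y e < Y v"
    have "e \<in> strip l r" using clean[OF e(1)] e by linarith
    with b w'(1) w'(2)[of e] show False by auto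
  qed (use assms w' in \<open>auto simp: strip_def\<close>)
  with w' assms show thesis by (intro that[of w']) auto
qed

lemma strip_apart:
  assumes "l < r" "v \<in> strip l r" "w \<in> strip l r" "Y v < Y w"
  shows "Y v + 1 \<le> Y w"
proof -
  have "\<bar>X v - X w\<bar> < 1" "v \<in> W" "w \<in> W" "v \<noteq> w" using assms by (auto simp: strip_def)
  then show ?thesis using apart[of v w] assms(4) by linarith
qed

text \<open>The band from \<open>u\<close> to \<open>w\<close> passes to the right of
  \<open>v\<close>. Let \<open>P\<close> be the rightmost right end among the squares left of the
  band and between \<open>u\<close> and \<open>w\<close> in height. Over a short interval ending at
  \<open>P\<close>, all squares between \<open>u\<close> and \<open>w\<close> end exactly at
  \<open>P\<close>; the first two above \<open>u\<close> alternate in side and are \<open>v1\<close>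
  and \<open>u1\<close>.\<close>

lemma aligned_stack:
  assumes "u \<in> U" "v \<in> V" "w \<in> V"
    and sv: "sees W X Y u v" and sw: "sees W X Y u w"
    and Y: "Y u < Y v" "Y v < Y w" and X: "X v < X w" "X w < X v + 1"
  obtains v1 u1 where "v1 \<in> V" "u1 \<in> U" "X v1 = X u1" "Y u + 1 \<le> Y v1" "Y v1 < Y u1"
    "X v \<le> X v1" "X v1 < X w"
proof -
  obtain p q where pq: "p < q" "X u \<le> p" "X w \<le> p" "q \<le> X u + 1" "q \<le> X w + 1"
    and gap: "\<And>e. e \<in> W \<Longrightarrow> Y u < Y e \<Longrightarrow> Y e < Y w \<Longrightarrow> X e + 1 \<le> p \<or> q \<le> X e"
    using sw by (rule seesE) blast
  let ?B = "{e \<in> W. Y u < Y e \<and> Y e < Y w \<and> X e + 1 \<le> p}"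
  have vB: "v \<in> ?B" using gap[of v] assms pq by auto
  have finB: "finite ?B" using finite_W by simp
  obtain e0 where e0: "e0 \<in> ?B" "\<And>e. e \<in> ?B \<Longrightarrow> X e \<le> X e0"
    using obtain_minimizer[of ?B "\<lambda>e. - X e"] finB vB by auto
  define P where "P = X e0 + 1"
  have Xv: "X v \<le> X e0" using e0(2) vB by blast
  have "X u < P" using sees_overlap[OF sv] Xv by (auto simp: P_def)
  obtain l where l: "P - 1 \<le> l" "l < P"
    "\<And>e. e \<in> W \<Longrightarrow> e \<in> strip l P \<or> P \<le> X e \<or> X e + 1 \<le> l"
    "\<And>e. e \<in> W \<Longrightarrow> X e < P \<Longrightarrow> X e \<le> l"
    using strip_left_of[of "P - 1" P] by auto
  \<comment> \<open>The overlap of \<open>v\<close> with \<open>u\<close> and with \<open>w\<close>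
    gives \<open>X u < P\<close> and \<open>X w < P\<close>; the band, starting at or after
    \<open>P\<close>, takes care of the right ends.\<close>
  have mem: "u \<in> strip l P" "w \<in> strip l P" "e0 \<in> strip l P"
    using assms e0(1) pq l(1) l(4)[of u] l(4)[of w] \<open>X u < P\<close> Xv
    by (auto simp: strip_def P_def)
  have aligned: "X e = X e0" if "e \<in> strip l P" "Y u < Y e" "Y e < Y w" for e
  proof -
    have e: "e \<in> W" "X e \<le> l" "P \<le> X e + 1" using that by (auto simp: strip_def)
    have "X e + 1 \<le> p" using gap[OF e(1) that(2,3)] e(2) l(2) e0(1) pq(1) by (auto simp: P_def)
    then have "X e \<le> X e0" using e0(2) e that by blast
    then show ?thesis using e by (simp add: P_def)
  qed
  obtain v1 where v1: "v1 \<in> strip l P" "Y u < Y v1" "Y v1 \<le> Y e0" "sees W X Y u v1"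
    using next_above[OF l(2,3) mem(1,3)] e0(1) by auto
  have v1w: "Y v1 < Y w" using v1(3) e0(1) by auto
  have v1V: "v1 \<in> V"
    using independent[of u v1] v1 assms by (auto simp: strip_def)
  obtain u1 where u1: "u1 \<in> strip l P" "Y v1 < Y u1" "Y u1 \<le> Y w" "sees W X Y v1 u1"
    using next_above[OF l(2,3) v1(1) mem(2) v1w] by auto
  have u1U: "u1 \<in> U"
    using independent[of v1 u1] u1 v1V by (auto simp: strip_def)
  \<comment> \<open>As \<open>w\<close> is in \<open>V\<close>, the square \<open>u1\<close> is
    strictly below it and hence aligned.\<close>
  have "u1 \<noteq> w" using u1U assms disjoint by auto
  then have "Y u1 \<noteq> Y w"
    using strip_apart[OF l(2)] apart[of u1 w] u1(1) mem(2) l(2) by (force simp: strip_def)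
  then have "Y u1 < Y w" using u1 by auto
  moreover have "X e0 < X w" using e0(1) pq by auto
  ultimately show thesis
    using that[OF v1V u1U] aligned[OF v1(1,2) v1w] aligned[of u1] u1 v1 Xv
      strip_apart[OF l(2) mem(1) v1(1)] by auto
qed

text \<open>From a lower \<open>x\<close>, the square \<open>u1\<close> would be hidden vertically
  by \<open>v1\<close>, and it is too high to be seen horizontally.\<close>

lemma aligned_lowest:
  assumes "v1 \<in> V" "u1 \<in> U" "X v1 = X u1" "Y v1 < Y u1" "x \<in> V"
  shows "Y v1 \<le> Y x"
proof (rule ccontr)
  assume low: "\<not> Y v1 \<le> Y x"
  have ap: "Y v1 + 1 \<le> Y u1"
    using apart[of v1 u1] assms disjoint by (cases "v1 = u1") auto
  consider "sees W X Y u1 x" | "sees W Y X u1 x" using adjacent assms by blast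
  then show False
  proof cases
    case 1
    then show False
    proof (rule seesE)
      fix p q
      assume "p < q" "X u1 \<le> p" "q \<le> X u1 + 1"
        and "\<And>e. e \<in> W \<Longrightarrow> Y x < Y e \<Longrightarrow> Y e < Y u1 \<Longrightarrow> X e + 1 \<le> p \<or> q \<le> X e"
      from this(1-3) this(4)[of v1] show False using assms low by auto
    qed
  next
    case 2
    then show False using sees_overlap[OF 2] ap low by linarith
  qed
qed

text \<open>The band meets \<open>u\<close>, so it cannot lie left of \<open>e\<close>; it starts at
  or after \<open>X e + 1\<close>, and \<open>v\<close> must reach beyond that point.\<close>

lemma lower_blocks:
  assumes "sees W X Y u v" "e \<in> W" "Y u < Y e" "Y e < Y v" "X e \<le> X u"
  shows "X e < X v"
  using assms(1)
proof (rule seesE)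
  fix p q
  assume "p < q" "X u \<le> p" "q \<le> X v + 1"
    and "\<And>e. e \<in> W \<Longrightarrow> Y u < Y e \<Longrightarrow> Y e < Y v \<Longrightarrow> X e + 1 \<le> p \<or> q \<le> X e"
  from this(1-3) this(4)[of e] show ?thesis using assms by auto
qed

text \<open>Of three such squares let \<open>a\<close> be the lowest and \<open>c\<close> above
  \<open>b\<close>. Then \<open>X b < X c\<close> and the projections overlap, so
  \<open>aligned_stack\<close> gives a \<open>v1\<close>, no higher than \<open>a\<close> and thus
  strictly below \<open>b\<close>. Being in the way of \<open>b\<close>, it has
  \<open>X v1 < X b\<close>, against \<open>X b \<le> X v1\<close>.\<close>

lemma three_on_left:
  assumes u: "u \<in> U"
    and A: "A \<subseteq> {v \<in> V. sees W X Y u v \<and> Y u < Y v \<and> X v \<le> X u}"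
  shows "card A \<le> 2"
proof (rule ccontr)
  assume "\<not> card A \<le> 2"
  have sub: "A \<subseteq> V" using A by auto
  then have finA: "Finite_Set.finite A" using finite(2) by (rule finite_subset)
  have rng: "X u - 1 < X v" "X v \<le> X u" if "v \<in> A" for v
    using that A sees_overlap[of W X Y u v] by auto
  have neq: "Y v \<noteq> Y w" if "v \<in> A" "w \<in> A" "v \<noteq> w" for v w
    using apart[of v w] rng[of v] rng[of w] that sub by fastforce
  have "A \<noteq> {}" using \<open>\<not> card A \<le> 2\<close> by auto
  obtain a where a: "a \<in> A" "\<And>e. e \<in> A \<Longrightarrow> Y a \<le> Y e"
    using obtain_minimizer[OF finA \<open>A \<noteq> {}\<close>, of Y] by blast
  have "\<not> card (A - {a}) \<le> 1" using \<open>\<not> card A \<le> 2\<close> finA a by simp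
  then obtain b c where bc: "b \<in> A - {a}" "c \<in> A - {a}" "b \<noteq> c"
    using finA card_le_Suc0_iff_eq[of "A - {a}"] by auto
  have main: False if bc: "b \<in> A - {a}" "c \<in> A - {a}" and lt: "Y b < Y c" for b c
  proof -
    have m: "b \<in> A" "c \<in> A" "b \<in> V" "c \<in> V" "sees W X Y u b" "sees W X Y u c" "Y u < Y b"
      using that A by auto
    have X: "X b < X c" using lower_blocks[OF m(6), of b] m lt rng[of b] by auto
    obtain v1 u1 where v1: "v1 \<in> V" "u1 \<in> U" "X v1 = X u1" "Y u + 1 \<le> Y v1" "Y v1 < Y u1"
      "X b \<le> X v1" "X v1 < X c"
      using aligned_stack[OF u m(3,4,5,6,7) lt X] rng[of b] rng[of c] m by auto
    have "Y v1 \<le> Y a" using aligned_lowest v1 a(1) sub by blast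
    also have "\<dots> < Y b" using a(2)[of b] neq[of a b] that a(1) m by force
    finally have "X v1 < X b"
      using lower_blocks[OF m(5), of v1] v1 rng[of c] m by auto
    with v1 show False by simp
  qed
  show False using main[of b c] main[of c b] neq[of b c] bc by force
qed

text \<open>As \<open>v1\<close> is lowest in \<open>V\<close>, all of \<open>V\<close> lies above
  \<open>u\<close> and out of its horizontal sight, and \<open>three_on_left\<close> applies on both
  sides.\<close>

lemma aligned_few:
  assumes u: "u \<in> U"
    and v1: "v1 \<in> V" "u1 \<in> U" "X v1 = X u1" "Y u + 1 \<le> Y v1" "Y v1 < Y u1"
  shows "card V \<le> 4"
proof -
  have *: "sees W X Y u v \<and> Y u < Y v" if "v \<in> V" for v
  proof -
    have "Y u + 1 \<le> Y v" using aligned_lowest[of v1 u1 v] v1 that by auto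
    then show ?thesis using adjacent[OF u that] sees_overlap[of W Y X u v] by auto
  qed
  interpret mir: bipartite_squares U V "\<lambda>e. - X e" Y by (rule mirrored_left)
  have "card {v \<in> V. X v \<le> X u} \<le> 2"
    using * by (intro three_on_left[OF u]) auto
  moreover have "card {v \<in> V. - X v \<le> - X u} \<le> 2"
    using * by (intro mir.three_on_left[OF u]) (auto intro: sees_uminus_left)
  moreover have "card V \<le> card ({v \<in> V. X v \<le> X u} \<union> {v \<in> V. - X v \<le> - X u})"
    using finite by (intro card_mono) auto
  ultimately show ?thesis
    using card_Un_le[of "{v \<in> V. X v \<le> X u}" "{v \<in> V. - X v \<le> - X u}"] by linarith
qed

section \<open>Neighbours in one direction\<close>

text \<open>An overlap would produce the stack that bounds \<open>card V\<close> by 4.\<close>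

lemma upper_neighbours_disjoint_less:
  assumes "5 \<le> card V" "u \<in> U" "v \<in> V" "w \<in> V"
    "sees W X Y u v" "sees W X Y u w" "Y u < Y v" "Y v < Y w" "X v < X w"
  shows "X v + 1 \<le> X w"
proof (rule ccontr)
  assume "\<not> X v + 1 \<le> X w"
  then have "X w < X v + 1" by simp
  then obtain v1 u1 where "v1 \<in> V" "u1 \<in> U" "X v1 = X u1" "Y u + 1 \<le> Y v1" "Y v1 < Y u1"
    by (rule aligned_stack[OF assms(2-)])
  then show False using aligned_few assms by fastforce
qed

text \<open>Equal heights are settled by \<open>separated\<close>. Otherwise equal \<open>X\<close>
  would let the lower square hide the upper one, and a reflection can put the lower one on the
  left.\<close>

lemma upper_neighbours_disjoint:
  assumes "5 \<le> card V" "u \<in> U" "v \<in> V" "w \<in> V" "v \<noteq> w"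
    "sees W X Y u v" "sees W X Y u w" "Y u < Y v" "Y u < Y w"
  shows "1 \<le> \<bar>X v - X w\<bar>"
proof -
  interpret mir: bipartite_squares U V "\<lambda>e. - X e" Y by (rule mirrored_left)
  have less_imp: "1 \<le> \<bar>X v - X w\<bar>"
    if m: "v \<in> V" "w \<in> V" "sees W X Y u v" "sees W X Y u w" "Y u < Y v" "Y v < Y w" for v w
  proof -
    have "X v \<noteq> X w"
    proof
      assume eq: "X v = X w"
      from m(4) show False
      proof (rule seesE)
        fix p q
        assume "p < q" "X w \<le> p" "q \<le> X w + 1"
          and "\<And>e. e \<in> W \<Longrightarrow> Y u < Y e \<Longrightarrow> Y e < Y w \<Longrightarrow> X e + 1 \<le> p \<or> q \<le> X e"
        from this(1-3) this(4)[of v] show False using m eq by auto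
      qed
    qed
    then consider "X v < X w" | "- X v < - X w" by linarith
    then show ?thesis
    proof cases
      case 1
      then show ?thesis using upper_neighbours_disjoint_less[OF assms(1,2) m] by linarith
    next
      case 2
      then show ?thesis
        using mir.upper_neighbours_disjoint_less[OF assms(1,2) m(1,2) _ _ m(5,6)] m
          sees_uminus_left by fastforce
    qed
  qed
  show ?thesis
  proof (cases "Y v" "Y w" rule: linorder_cases)
    case less
    then show ?thesis using less_imp[of v w] assms by blast
  next
    case equal
    then show ?thesis using separated[of v w] assms by auto
  next
    case greater
    then show ?thesis using less_imp[of w v] assms by (simp add: abs_minus_commute)
  qed
qed

text \<open>Three corners at mutual distance at least 1 do not fit into the open interval of length
  2 around \<open>X u\<close>.\<close>

lemma upper_neighbours_le_2:
  assumes "5 \<le> card V" "u \<in> U"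
  shows "card {v \<in> V. sees W X Y u v \<and> Y u < Y v} \<le> 2" (is "card ?A \<le> 2")
proof (rule ccontr)
  assume "\<not> card ?A \<le> 2"
  then have "3 \<le> card ?A" by simp
  then obtain T where "T \<subseteq> ?A" "card T = 3" by (meson obtain_subset_with_card_n)
  then obtain a b c where "{a, b, c} \<subseteq> ?A" "a \<noteq> b" "b \<noteq> c" "a \<noteq> c"
    by (auto simp: card_3_iff)
  then have "1 \<le> \<bar>X a - X b\<bar>" "1 \<le> \<bar>X b - X c\<bar>" "1 \<le> \<bar>X a - X c\<bar>"
    "\<bar>X u - X a\<bar> < 1" "\<bar>X u - X b\<bar> < 1" "\<bar>X u - X c\<bar> < 1"
    using upper_neighbours_disjoint[OF assms] sees_overlap by auto
  then show False by linarith
qed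

lemma two_upper_neighbours:
  assumes "5 \<le> card V" "u \<in> U" "2 \<le> card {v \<in> V. sees W X Y u v \<and> Y u < Y v}"
  obtains v1 v2 where "v1 \<in> V" "v2 \<in> V" "Y u + 1 \<le> Y v1" "Y u + 1 \<le> Y v2"
    "X u - 1 < X v1" "X v1 < X u" "X u < X v2" "X v2 < X u + 1"
proof -
  let ?A = "{v \<in> V. sees W X Y u v \<and> Y u < Y v}"
  obtain T where "T \<subseteq> ?A" "card T = 2" using assms(3) by (meson obtain_subset_with_card_n)
  then obtain a b where ab: "{a, b} \<subseteq> ?A" "a \<noteq> b" by (auto simp: card_2_iff)
  have "1 \<le> \<bar>X a - X b\<bar>"
    using upper_neighbours_disjoint[OF assms(1,2)] ab by auto
  moreover have "v \<in> V" "\<bar>X u - X v\<bar> < 1" "Y u + 1 \<le> Y v" if "v \<in> {a, b}" for v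
    using that ab(1) sees_overlap[of W X Y u v] sees_apart[of u v] assms(2) by auto
  ultimately have ab: "1 \<le> \<bar>X a - X b\<bar>" "\<bar>X u - X a\<bar> < 1" "\<bar>X u - X b\<bar> < 1"
    "Y u + 1 \<le> Y a" "Y u + 1 \<le> Y b" "a \<in> V" "b \<in> V" by auto
  show thesis
  proof (cases "X a < X b")
    case True
    then show thesis using ab by (intro that[of a b]) linarith+
  next
    case False
    then show thesis using ab by (intro that[of b a]) linarith+
  qed
qed

section \<open>Neighbours in opposite directions\<close>

text \<open>A vertical band would lie between \<open>X z\<close> and \<open>X u' + 1\<close>, where
  \<open>u\<close> is in the way; horizontally the heights differ by at least 2.\<close>

lemma not_sees_behind:
  assumes "u \<in> U" "u' \<in> U" "z \<in> V"
    "Y u + 1 \<le> Y u'" "Y z + 1 \<le> Y u" "X u' < X u" "X u < X z"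
  shows False
proof -
  consider "sees W X Y u' z" | "sees W Y X u' z" using adjacent assms by blast
  then show False
  proof cases
    case 1
    then show False
    proof (rule seesE)
      fix p q
      assume "p < q" "X z \<le> p" "q \<le> X u' + 1"
        and "\<And>e. e \<in> W \<Longrightarrow> Y z < Y e \<Longrightarrow> Y e < Y u' \<Longrightarrow> X e + 1 \<le> p \<or> q \<le> X e"
      from this(1-3) this(4)[of u] show False using assms by auto
    qed
  next
    case 2
    then show False using sees_overlap[OF 2] assms by linarith
  qed
qed

text \<open>The squares share a piece of edge, so an obstacle with its corner between theirs would
  overlap \<open>u\<close>.\<close>

lemma touching_sees:
  assumes "u \<in> W" "u' \<in> W" "X u' = X u - 1" "\<bar>Y u - Y u'\<bar> < 1"
  shows "sees W Y X u u'"
proof (rule seesI[of "max (Y u) (Y u')" "min (Y u) (Y u') + 1"])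
  fix e t
  assume "e \<in> W" "max (Y u) (Y u') < t" "t < min (Y u) (Y u') + 1" "Y e < t" "t < Y e + 1"
    "X u < X e \<and> X e < X u' \<or> X u' < X e \<and> X e < X u"
  then have "\<bar>X e - X u\<bar> < 1" "\<bar>Y e - Y u\<bar> < 1" "e \<noteq> u" using assms by auto
  then show False using separated[of e u] assms(1) \<open>e \<in> W\<close> by auto
qed (use assms in auto)

text \<open>The separator \<open>u'\<close> just above \<open>z1\<close> lies above, below or beside
  \<open>u\<close>. In the first two cases \<open>u\<close> hides \<open>z2\<close> or
  \<open>v2\<close> from it; in the third it touches \<open>u\<close> and is seen by it.\<close>

lemma vertical_neighbours_le_3:
  assumes "5 \<le> card V" "u \<in> U"
  shows "card {v \<in> V. sees W X Y u v} \<le> 3"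
proof (rule ccontr)
  assume 4: "\<not> card {v \<in> V. sees W X Y u v} \<le> 3"
  interpret mir: bipartite_squares U V X "\<lambda>e. - Y e" by (rule mirrored_right)
  have iff: "sees W X (\<lambda>e. - Y e) u v \<longleftrightarrow> sees W X Y u v" for v
    using sees_uminus_right[of W X Y u v] sees_uminus_right[of W X "\<lambda>e. - Y e" u v] by auto
  let ?A = "{v \<in> V. sees W X Y u v \<and> Y u < Y v}"
  let ?B = "{v \<in> V. sees W X Y u v \<and> - Y u < - Y v}"
  have "{v \<in> V. sees W X Y u v} \<subseteq> ?A \<union> ?B"
    using sees_apart assms(2) by force
  then have "card {v \<in> V. sees W X Y u v} \<le> card (?A \<union> ?B)"
    using finite by (intro card_mono) auto
  also have "\<dots> \<le> card ?A + card ?B" by (rule card_Un_le)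
  finally have "4 \<le> card ?A + card ?B" using 4 by linarith
  then have AB: "2 \<le> card ?A" "2 \<le> card ?B"
    using upper_neighbours_le_2[OF assms] mir.upper_neighbours_le_2[OF assms] by (simp_all add: iff)
  obtain v1 v2 where v: "v1 \<in> V" "v2 \<in> V" "Y u + 1 \<le> Y v1" "Y u + 1 \<le> Y v2"
    "X u - 1 < X v1" "X v1 < X u" "X u < X v2" "X v2 < X u + 1"
    using two_upper_neighbours[OF assms AB(1)] .
  obtain z1 z2 where z: "z1 \<in> V" "z2 \<in> V" "- Y u + 1 \<le> - Y z1" "- Y u + 1 \<le> - Y z2"
    "X u - 1 < X z1" "X z1 < X u" "X u < X z2" "X z2 < X u + 1"
    by (rule mir.two_upper_neighbours[OF assms]) (use AB(2) in \<open>simp_all add: iff\<close>)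
  \<comment> \<open>Ending the strip at the left edge of \<open>u\<close> keeps \<open>u\<close>
    itself out of it.\<close>
  obtain l where l: "X u - 1 \<le> l" "l < X u"
    "\<And>e. e \<in> W \<Longrightarrow> e \<in> strip l (X u) \<or> X u \<le> X e \<or> X e + 1 \<le> l"
    "\<And>e. e \<in> W \<Longrightarrow> X e < X u \<Longrightarrow> X e \<le> l"
    using strip_left_of[of "X u - 1" "X u"] by auto
  have "v1 \<in> strip l (X u)" "z1 \<in> strip l (X u)" "Y z1 < Y v1"
    using v z l(4)[of v1] l(4)[of z1] by (auto simp: strip_def)
  then obtain u' where u': "u' \<in> strip l (X u)" "sees W X Y z1 u'" "Y z1 < Y u'"
    using next_above[OF l(2,3)] by blast
  then have "z1 \<noteq> u'" by auto
  have "u' \<in> U"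
    using independent[of z1 u'] u' z(1) \<open>z1 \<noteq> u'\<close> by (auto simp: strip_def)
  have X': "X u - 1 \<le> X u'" "X u' < X u" using u'(1) l(2) by (auto simp: strip_def)
  consider "Y u + 1 \<le> Y u'" | "- Y u + 1 \<le> - Y u'" | "\<bar>Y u - Y u'\<bar> < 1" by linarith
  then show False
  proof cases
    case 1
    then show False using not_sees_behind[OF assms(2) \<open>u' \<in> U\<close> z(2)] X' z by auto
  next
    case 2
    then show False using mir.not_sees_behind[OF assms(2) \<open>u' \<in> U\<close> v(2)] X' v by auto
  next
    case 3
    \<comment> \<open>\<open>u'\<close> reaches \<open>X u\<close> from the left and cannot overlap
      \<open>u\<close>.\<close>
    then have "X u' = X u - 1"
      using separated[of u u'] X' assms(2) \<open>u' \<in> U\<close> by force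
    then have "sees W Y X u u'"
      using touching_sees 3 assms(2) \<open>u' \<in> U\<close> by auto
    then show False using independent[of u u'] assms(2) \<open>u' \<in> U\<close> X' by auto
  qed
qed

theorem card_le_6:
  assumes "u \<in> U"
  shows "card V \<le> 6"
proof (rule ccontr)
  assume "\<not> card V \<le> 6"
  then have V: "5 \<le> card V" by simp
  have "V = {v \<in> V. sees W X Y u v} \<union> {v \<in> V. sees W Y X u v}"
    using adjacent[OF assms] by blast
  then have "card V \<le> card ({v \<in> V. sees W X Y u v} \<union> {v \<in> V. sees W Y X u v})"
    by simp
  also have "\<dots> \<le> card {v \<in> V. sees W X Y u v} + card {v \<in> V. sees W Y X u v}"
    by (rule card_Un_le)
  also have "\<dots> \<le> 3 + 3"
    using vertical_neighbours_le_3[OF V assms] bipartite_squares.vertical_neighbours_le_3[OF transposed V assms]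
    by linarith
  finally show False using \<open>\<not> card V \<le> 6\<close> by simp
qed

end

section \<open>From squares to corner coordinates\<close>

definition square_at :: "real \<Rightarrow> real \<Rightarrow> (real \<times> real) set" where
  "square_at a b = {a..a + 1} \<times> {b..b + 1}"

lemma interior_square_at: "interior (square_at a b) = {a<..<a + 1} \<times> {b<..<b + 1}"
  by (simp add: square_at_def interior_Times)

lemma swap_square_at: "prod.swap ` square_at a b = square_at b a"
  by (simp add: square_at_def product_swap)

lemma square_at_disjoint_iff:
  "interior (square_at a b) \<inter> interior (square_at c d) = {} \<longleftrightarrow> 1 \<le> \<bar>a - c\<bar> \<or> 1 \<le> \<bar>b - d\<bar>"
proof -
  have *: "{s<..<s + 1} \<inter> {t<..<t + 1} = {} \<longleftrightarrow> 1 \<le> \<bar>s - t\<bar>" for s t :: real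
    by (auto simp: Int_greaterThanLessThan)
  show ?thesis
    unfolding interior_square_at Times_Int_Times Times_empty * ..
qed

text \<open>Each alternative in \<open>between\<close> is tightest at the facing edges, such as
  \<open>s = a + 1\<close> and \<open>t = c\<close>; the line meets both squares, so these points
  are available.\<close>

lemma between_square_at:
  assumes "y \<in> {b..b + 1}" "y \<in> {d..d + 1}"
  shows "between (square_at a b) (square_at c d) y =
    {(x, y) | x. a + 1 \<le> x \<and> x \<le> c \<or> c + 1 \<le> x \<and> x \<le> a}"
proof -
  have *: "(\<forall>s t. (s, y) \<in> square_at a b \<longrightarrow> (t, y) \<in> square_at c d \<longrightarrow> s \<le> x \<and> x \<le> t) \<longleftrightarrow>
      a + 1 \<le> x \<and> x \<le> c" (is "?L \<longleftrightarrow> ?R")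
    if "y \<in> {b..b + 1}" "y \<in> {d..d + 1}" for a b c d x
  proof
    assume ?L
    from this[rule_format, of "a + 1" c] that show ?R by (simp add: square_at_def)
  qed (auto simp: square_at_def)
  have "(\<forall>s t. (s, y) \<in> square_at a b \<longrightarrow> (t, y) \<in> square_at c d \<longrightarrow> t \<le> x \<and> x \<le> s) \<longleftrightarrow>
      c + 1 \<le> x \<and> x \<le> a" for x
    using *[OF assms(2,1), of c a x] by blast
  then show ?thesis unfolding between_def *[OF assms] by simp
qed

text \<open>A square met by the same line is separated from \<open>v\<close> and \<open>w\<close>
  along \<open>X\<close>, so its interior meets the segment between them exactly if its corner lies
  strictly between theirs; its midpoint is then a witness.\<close>

lemma horizontal_band_iff_sees:
  assumes S: "\<And>e. e \<in> W \<Longrightarrow> S e = square_at (X e) (Y e)"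
    and sep: "\<And>e f. e \<in> W \<Longrightarrow> f \<in> W \<Longrightarrow> e \<noteq> f \<Longrightarrow> 1 \<le> \<bar>X e - X f\<bar> \<or> 1 \<le> \<bar>Y e - Y f\<bar>"
    and vw: "v \<in> W" "w \<in> W"
  shows "horizontal_band W S v w \<longleftrightarrow> sees W Y X v w"
proof -
  have blocked: "(\<forall>u\<in>W - {v, w}. between (S v) (S w) t \<inter> interior (S u) = {}) \<longleftrightarrow>
      (\<forall>e\<in>W - {v, w}. t \<in> {Y e<..<Y e + 1} \<longrightarrow>
        \<not> (X v < X e \<and> X e < X w) \<and> \<not> (X w < X e \<and> X e < X v))"
    if t: "t \<in> {Y v<..<Y v + 1}" "t \<in> {Y w<..<Y w + 1}" for t
  proof (rule ball_cong[OF refl])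
    fix e assume e: "e \<in> W - {v, w}"
    have btw: "between (S v) (S w) t =
        {(x, t) | x. X v + 1 \<le> x \<and> x \<le> X w \<or> X w + 1 \<le> x \<and> x \<le> X v}"
      unfolding S[OF vw(1)] S[OF vw(2)] using t by (intro between_square_at) auto
    have int: "interior (S e) = {X e<..<X e + 1} \<times> {Y e<..<Y e + 1}"
      using e S interior_square_at by auto
    show "between (S v) (S w) t \<inter> interior (S e) = {} \<longleftrightarrow>
        (t \<in> {Y e<..<Y e + 1} \<longrightarrow>
          \<not> (X v < X e \<and> X e < X w) \<and> \<not> (X w < X e \<and> X e < X v))"
    proof (cases "t \<in> {Y e<..<Y e + 1}")
      case True
      then have "1 \<le> \<bar>X e - X v\<bar>" "1 \<le> \<bar>X e - X w\<bar>"
        using sep[of e v] sep[of e w] e vw t by auto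
      then have "(\<exists>x. x \<in> {X e<..<X e + 1} \<and>
          (X v + 1 \<le> x \<and> x \<le> X w \<or> X w + 1 \<le> x \<and> x \<le> X v)) \<longleftrightarrow>
          (X v < X e \<and> X e < X w) \<or> (X w < X e \<and> X e < X v)"
        by (intro iffI exI[of _ "X e + 1 / 2"]) auto
      moreover have "between (S v) (S w) t \<inter> interior (S e) = {} \<longleftrightarrow>
          \<not> (\<exists>x. x \<in> {X e<..<X e + 1} \<and>
            (X v + 1 \<le> x \<and> x \<le> X w \<or> X w + 1 \<le> x \<and> x \<le> X v))"
        unfolding btw int using True by blast
      ultimately show ?thesis using True by simp
    next
      case False
      then show ?thesis unfolding btw int by auto
    qed
  qed
  have meets: "(\<exists>x. (x, t) \<in> interior (S e)) \<longleftrightarrow> t \<in> {Y e<..<Y e + 1}" if "e \<in> W" for e t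
    using S[OF that] dense[of "X e" "X e + 1"] by (auto simp: interior_square_at)
  have "(\<exists>x. (x, t) \<in> interior (S v)) \<and> (\<exists>x. (x, t) \<in> interior (S w)) \<and>
        (\<forall>u\<in>W - {v, w}. between (S v) (S w) t \<inter> interior (S u) = {}) \<longleftrightarrow>
      t \<in> {Y v<..<Y v + 1} \<and> t \<in> {Y w<..<Y w + 1} \<and>
        (\<forall>e\<in>W - {v, w}. t \<in> {Y e<..<Y e + 1} \<longrightarrow>
          \<not> (X v < X e \<and> X e < X w) \<and> \<not> (X w < X e \<and> X e < X v))" for t
    unfolding meets[OF vw(1)] meets[OF vw(2)] by (intro conj_cong refl blocked)
  then show ?thesis
    unfolding horizontal_band_def sees_def by (simp only:)
qed

lemma vertical_band_iff_sees:
  assumes "\<And>e. e \<in> W \<Longrightarrow> S e = square_at (X e) (Y e)"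
    and "\<And>e f. e \<in> W \<Longrightarrow> f \<in> W \<Longrightarrow> e \<noteq> f \<Longrightarrow> 1 \<le> \<bar>X e - X f\<bar> \<or> 1 \<le> \<bar>Y e - Y f\<bar>"
    and "v \<in> W" "w \<in> W"
  shows "vertical_band W S v w \<longleftrightarrow> sees W X Y v w"
  unfolding vertical_band_def
  using assms by (intro horizontal_band_iff_sees) (auto simp: swap_square_at disj_commute)

theorem lemma5p4:
  fixes m n :: nat and G :: "('a, 'b) pre_digraph"
  assumes "1 \<le> m" and "m \<le> n" and "7 \<le> n" and "K\<^bsub>m,n\<^esub> G"
  shows "\<not> unit_rectangle_visibility_graph G"
proof
  assume "unit_rectangle_visibility_graph G"
  then obtain S where S: "unit_rectangle_visibility_representation G S"
    by (auto simp: unit_rectangle_visibility_graph_def)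
  obtain U V where UV: "graph G" "verts G = U \<union> V" "U \<inter> V = {}" "card U = m" "card V = n"
    "arcs_ends G = U \<times> V \<union> V \<times> U"
    using assms(4) by (auto simp: complete_bipartite_digraph_def)
  have "\<forall>e\<in>U \<union> V. \<exists>a b. S e = square_at a b"
    using S UV(2)
    by (auto simp: unit_rectangle_visibility_representation_def unit_square_def square_at_def)
  then obtain X Y where XY: "\<And>e. e \<in> U \<union> V \<Longrightarrow> S e = square_at (X e) (Y e)"
    by (auto simp: bchoice_iff)
  have sep: "1 \<le> \<bar>X v - X w\<bar> \<or> 1 \<le> \<bar>Y v - Y w\<bar>" if "v \<in> U \<union> V" "w \<in> U \<union> V" "v \<noteq> w" for v w
    using S that XY[of v] XY[of w] square_at_disjoint_iff UV(2)
    unfolding unit_rectangle_visibility_representation_def by metis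
  \<comment> \<open>Pairs from opposite sides yield \<open>adjacent\<close>, pairs from one side
    \<open>independent\<close>.\<close>
  have vis: "(v, w) \<in> U \<times> V \<union> V \<times> U \<longleftrightarrow> sees (U \<union> V) Y X v w \<or> sees (U \<union> V) X Y v w"
    if "v \<in> U \<union> V" "w \<in> U \<union> V" "v \<noteq> w" for v w
  proof -
    have "(v, w) \<in> arcs_ends G \<longleftrightarrow>
        horizontal_band (U \<union> V) S v w \<or> vertical_band (U \<union> V) S v w"
      using S that UV(2) unfolding unit_rectangle_visibility_representation_def by auto
    then show ?thesis
      using horizontal_band_iff_sees[OF XY sep that(1,2)]
        vertical_band_iff_sees[OF XY sep that(1,2)] UV(6) by simp
  qed
  interpret bipartite_squares U V X Y
  proof
    show "finite U" "finite V"
      using UV(4,5) assms by (auto intro: card_ge_0_finite)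
  next
    fix u v
    assume "u \<in> U" "v \<in> V"
    then show "sees (U \<union> V) X Y u v \<or> sees (U \<union> V) Y X u v"
      using vis[of u v] UV(3) by auto
  next
    fix v w
    assume "v \<in> U \<and> w \<in> U \<or> v \<in> V \<and> w \<in> V" "v \<noteq> w"
    then show "\<not> sees (U \<union> V) X Y v w \<and> \<not> sees (U \<union> V) Y X v w"
      using vis[of v w] UV(3) by auto
  qed (use sep UV(3) in auto)
  \<comment> \<open>\<open>1 \<le> m\<close> supplies the square whose neighbours are
    counted.\<close>
  obtain u where "u \<in> U" using UV(4) assms(1) by (metis card.empty ex_in_conv not_one_le_zero)
  then show False using card_le_6 UV(5) assms(3) by fastforce
qed

end
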